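(* Let $f\colon \mathbb{S}^{n\times n}\to\mathbb{R}$ be twice continuously differentiable. If $Y\in \mathrm{St}(d,p)^m$ is rank-deficient (i.e., $\operatorname{rank}(Y)<p$) and is a second-order critical point of $(\mathrm{RP}_p)$, then $X=YY^\top$ is a KKT point of $(\mathrm{P})$.
   Context: Integers satisfy $m\ge 1$, $1\le d\le p\le n=md$. $\mathbb{S}^{k\times k}$ is the space of real symmetric $k\times k$ matrices. Matrices $M\in\mathbb{R}^{n\times n}$ are viewed as $m\times m$ block matrices with blocks $M_{ij}\in\mathbb{R}^{d\times d}$; $Y\in\mathbb{R}^{n\times p}$ is viewed as a stack of slices $Y_1,\dots,Y_m\in\mathbb{R}^{d\times p}$. Inner product: $\langle A,B\rangle=\operatorname{trace}(A^\top B)$. $\nabla f(X)\in\mathbb{S}^{n\times n}$ and $\nabla^2 f(X)$ are the Euclidean gradient and Hessian operator of $f$ on $\mathbb{S}^{n\times n}$. Define $\mathrm{St}(d,p)^m=\{Y\in\mathbb{R}^{n\times p}: Y_iY_i^\top=I_d,\ i=1,\dots,m\}$ and $\mathcal{C}=\{X\in\mathbb{S}^{n\times n}: X\succeq 0,\ X_{ii}=I_d,\ i=1,\dots,m\}$. Problem $(\mathrm{P})$: minimize $f(X)$ over $X\in\mathcal{C}$. Problem $(\mathrm{RP}_p)$: minimize $g(Y)=f(YY^\top)$ over $Y\in\mathrm{St}(d,p)^m$. $\operatorname{symblockdiag}(M)$ is the matrix with diagonal blocks $(M_{ii}+M_{ii}^\top)/2$ and all other blocks zero. The tangent space is $\mathrm{T}_Y\mathrm{St}(d,p)^m=\{\dot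 Y\in\mathbb{R}^{n\times p}:\operatorname{symblockdiag}(\dot YY^\top+Y\dot Y^\top)=0\}$. With $X=YY^\top$, $Y\in\mathrm{St}(d,p)^m$ is a critical point of $(\mathrm{RP}_p)$ if the Riemannian gradient of $g$ vanishes, i.e. $(\nabla f(X)-\operatorname{symblockdiag}(\nabla f(X)X))Y=0$. It is a second-order critical point if moreover the Riemannian Hessian is positive semidefinite, i.e. $\langle\dot Y,\nabla^2 g(Y)[\dot Y]-\operatorname{symblockdiag}(\nabla g(Y)Y^\top)\dot Y\rangle\ge 0$ for all $\dot Y\in\mathrm{T}_Y\mathrm{St}(d,p)^m$, where $\nabla g(Y)=2\nabla f(X)Y$ and $\nabla^2g(Y)[\dot Y]=2(\nabla^2f(X)[\dot X]Y+\nabla f(X)\dot Y)$ with $\dot X=\dot YY^\top+Y\dot Y^\top$. $X\in\mathcal{C}$ is a KKT point of $(\mathrm{P})$ if there exist $\hat S\in\mathbb{S}^{n\times n}$ and a symmetric block-diagonal (with $d\times d$ blocks) $\hat\Lambda\in\mathbb{S}^{n\times n}$ such that $\hat SX=0$, $\hat S=\nabla f(X)+\hat\Lambda$ and $\hat S\succeq 0$. *)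

theory Defs
  imports "HOL-Analysis.Analysis"
begin

text \<open>
  With \<open>n = md\<close>, the index set of size \<open>n\<close> is the product \<open>'m \<times> 'd\<close>, so that \<open>(i, k)\<close>
  is position \<open>k\<close> of block \<open>i\<close>; here \<open>CARD('m) = m\<close>, \<open>CARD('d) = d\<close> and
  \<open>CARD('m \<times> 'd) = md\<close>. The number of columns of \<open>Y\<close> is \<open>p = CARD('p)\<close>.
\<close>

type_synonym ('m, 'd) bmat = "real ^ ('m \<times> 'd) ^ ('m \<times> 'd)"
type_synonym ('m, 'd, 'p) bstack = "real ^ 'p ^ ('m \<times> 'd)"

definition block :: "('m::finite, 'd::finite) bmat \<Rightarrow> 'm \<Rightarrow> 'm \<Rightarrow> real ^ 'd ^ 'd" where
  "block M i j = (\<chi> k l. M $ (i, k) $ (j, l))"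

definition slice :: "('m::finite, 'd::finite, 'p::finite) bstack \<Rightarrow> 'm \<Rightarrow> real ^ 'p ^ 'd" where
  "slice Y i = (\<chi> k. Y $ (i, k))"

definition mat_inner :: "real ^ 'b::finite ^ 'a::finite \<Rightarrow> real ^ 'b ^ 'a \<Rightarrow> real" where
  "mat_inner A B = trace (transpose A ** B)"

lemma mat_inner_eq_inner: "mat_inner A B = A \<bullet> B"
proof -
  have "mat_inner A B = (\<Sum>i\<in>UNIV. \<Sum>k\<in>UNIV. A $ k $ i * B $ k $ i)"
    by (simp add: mat_inner_def trace_def matrix_matrix_mult_def transpose_def)
  also have "\<dots> = (\<Sum>k\<in>UNIV. \<Sum>i\<in>UNIV. A $ k $ i * B $ k $ i)"
    by (rule sum.swap)
  finally show ?thesis by (simp add: inner_vec_def)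
qed

definition sym_mats :: "(real ^ 'a::finite ^ 'a) set" where
  "sym_mats = {A. transpose A = A}"

definition psd :: "real ^ 'a::finite ^ 'a \<Rightarrow> bool" where
  "psd A \<longleftrightarrow> A \<in> sym_mats \<and> (\<forall>x. 0 \<le> x \<bullet> (A *v x))"


section \<open>Calculus on the space of symmetric matrices\<close>

text \<open>
  A function on symmetric matrices is represented by a function on all square matrices, of which
  only the values on \<^const>\<open>sym_mats\<close> matter: all derivatives are taken within \<^const>\<open>sym_mats\<close>.
  The gradient is the symmetric matrix representing the derivative. The Hessian
  \<open>\<nabla>\<^sup>2 f(X)\<close> is the derivative of the gradient, an operator that is determined on (and only meant to
  be applied to) symmetric matrices.
\<close>

definition sym_grad :: "(real ^ 'a::finite ^ 'a \<Rightarrow> real) \<Rightarrow> real ^ 'a ^ 'a \<Rightarrow> real ^ 'a ^ 'a" where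
  "sym_grad f X =
     (THE G. G \<in> sym_mats \<and> (f has_derivative (\<lambda>H. mat_inner G H)) (at X within sym_mats))"

definition sym_hess ::
  "(real ^ 'a::finite ^ 'a \<Rightarrow> real) \<Rightarrow> real ^ 'a ^ 'a \<Rightarrow> real ^ 'a ^ 'a \<Rightarrow> real ^ 'a ^ 'a" where
  "sym_hess f X = frechet_derivative (sym_grad f) (at X within sym_mats)"

text \<open>
  Continuity of the second derivative is stated pointwise on directions, which in finite dimension
  is the same as continuity in operator norm.
\<close>

definition twice_cont_diff :: "(real ^ 'a::finite ^ 'a \<Rightarrow> real) \<Rightarrow> bool" where
  "twice_cont_diff f \<longleftrightarrow>
     f differentiable_on sym_mats \<and>
     sym_grad f differentiable_on sym_mats \<and>
     (\<forall>H\<in>sym_mats. continuous_on sym_mats (\<lambda>X. sym_hess f X H))"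

lemma subspace_sym_mats: "subspace (sym_mats :: (real ^ 'a::finite ^ 'a) set)"
  by (auto simp: subspace_def sym_mats_def transpose_def vec_eq_iff)

lemma has_derivative_within_subspace_unique:
  fixes f :: "'a::real_normed_vector \<Rightarrow> 'b::real_normed_vector"
  assumes S: "subspace S" "x \<in> S" "h \<in> S"
    and f': "(f has_derivative f') (at x within S)"
    and f'': "(f has_derivative f'') (at x within S)"
  shows "f' h = f'' h"
proof -
  have line: "((\<lambda>t::real. x + t *\<^sub>R h) has_derivative (\<lambda>t. t *\<^sub>R h)) (at 0)"
    by (auto intro!: derivative_eq_intros)
  have sub: "range (\<lambda>t. x + t *\<^sub>R h) \<subseteq> S"
    using S by (auto intro: subspace_add subspace_mul)
  have comp: "((\<lambda>t. f (x + t *\<^sub>R h)) has_derivative (\<lambda>t. D (t *\<^sub>R h))) (at 0)"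
    if "(f has_derivative D) (at x within S)" for D
  proof (rule has_derivative_in_compose[OF line])
    show "(f has_derivative D) (at (x + 0 *\<^sub>R h) within range (\<lambda>t. x + t *\<^sub>R h))"
      using has_derivative_subset[OF that sub] by simp
  qed
  have "(\<lambda>t. f' (t *\<^sub>R h)) = (\<lambda>t. f'' (t *\<^sub>R h))"
    using has_derivative_unique[OF comp[OF f'] comp[OF f'']] .
  from fun_cong[OF this, of 1] show ?thesis by simp
qed

lemma sym_grad_ex1:
  fixes f :: "real ^ 'a::finite ^ 'a \<Rightarrow> real"
  assumes "f differentiable (at X within sym_mats)" and X: "X \<in> sym_mats"
  shows "\<exists>!G. G \<in> sym_mats \<and> (f has_derivative (\<lambda>H. mat_inner G H)) (at X within sym_mats)"
proof -
  obtain D where D: "(f has_derivative D) (at X within sym_mats)"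
    using assms(1) by (auto simp: differentiable_def)
  interpret D: bounded_linear D using D by (rule has_derivative_bounded_linear)
  define A where "A = (\<Sum>b\<in>Basis. D b *\<^sub>R b)"
  define G where "G = (1/2) *\<^sub>R (A + transpose A)"
  have A: "D H = A \<bullet> H" for H
  proof -
    have "D H = D (\<Sum>b\<in>Basis. (H \<bullet> b) *\<^sub>R b)" by (simp add: euclidean_representation)
    also have "\<dots> = (\<Sum>b\<in>Basis. D b * (b \<bullet> H))"
      by (simp only: D.sum D.scaleR real_scaleR_def inner_commute[of H] mult.commute[of "D _"])
    also have "\<dots> = A \<bullet> H"
      by (simp add: A_def inner_sum_left)
    finally show ?thesis .
  qed
  have tr: "transpose A \<bullet> H = A \<bullet> H" if "H \<in> sym_mats" for H
  proof -
    have "transpose A \<bullet> H = (\<Sum>i\<in>UNIV. \<Sum>j\<in>UNIV. A $ j $ i * H $ i $ j)"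
      by (simp add: inner_vec_def transpose_def)
    also have "\<dots> = (\<Sum>j\<in>UNIV. \<Sum>i\<in>UNIV. A $ j $ i * H $ i $ j)" by (rule sum.swap)
    also have "\<dots> = A \<bullet> transpose H" by (simp add: inner_vec_def transpose_def)
    finally show ?thesis using that by (simp add: sym_mats_def)
  qed
  have G: "G \<in> sym_mats"
    by (simp add: G_def sym_mats_def transpose_def vec_eq_iff add.commute)
  have DG: "D H = mat_inner G H" if "H \<in> sym_mats" for H
    using tr[OF that] by (simp add: A mat_inner_eq_inner G_def inner_add_left)
  have lin: "bounded_linear (mat_inner G)"
    unfolding mat_inner_eq_inner[abs_def] by (rule bounded_linear_inner_right)
  have hd: "(f has_derivative mat_inner G) (at X within sym_mats)"
  proof (rule has_derivative_transform_within[where d = 1 and f = f])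
    have ev: "D (Z - X) = mat_inner G (Z - X)" if "Z \<in> sym_mats" for Z
      using that X by (intro DG subspace_diff[OF subspace_sym_mats])
    show "(f has_derivative mat_inner G) (at X within sym_mats)"
      using D lin ev by (simp add: has_derivative_within_alt)
  qed (use X in auto)
  show ?thesis
  proof (rule ex1I[of _ G])
    fix G' assume G': "G' \<in> sym_mats \<and> (f has_derivative (\<lambda>H. mat_inner G' H)) (at X within sym_mats)"
    have mem: "G' - G \<in> sym_mats"
      using G' G by (intro subspace_diff[OF subspace_sym_mats]) auto
    have "mat_inner G' (G' - G) = mat_inner G (G' - G)"
      using has_derivative_within_subspace_unique[OF subspace_sym_mats X mem _ hd] G' by auto
    then have "(G' - G) \<bullet> (G' - G) = 0"
      by (simp add: mat_inner_eq_inner inner_diff_left)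
    then show "G' = G" by simp
  qed (use G hd in auto)
qed

lemma sym_grad:
  fixes f :: "real ^ 'a::finite ^ 'a \<Rightarrow> real"
  assumes "f differentiable (at X within sym_mats)" and "X \<in> sym_mats"
  shows "sym_grad f X \<in> sym_mats"
    and "(f has_derivative (\<lambda>H. mat_inner (sym_grad f X) H)) (at X within sym_mats)"
  using theI'[OF sym_grad_ex1[OF assms]] by (auto simp: sym_grad_def)

lemma sym_hess_eq:
  assumes "(sym_grad f has_derivative D) (at X within sym_mats)" "X \<in> sym_mats" "H \<in> sym_mats"
  shows "sym_hess f X H = D H"
proof -
  have "(sym_grad f has_derivative sym_hess f X) (at X within sym_mats)"
    using assms(1) unfolding sym_hess_def
    by (auto simp: differentiable_def simp flip: frechet_derivative_works)
  from has_derivative_within_subspace_unique[OF subspace_sym_mats assms(2,3) this assms(1)]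
  show ?thesis .
qed


section \<open>The two problems\<close>

definition stiefel_prod :: "('m::finite, 'd::finite, 'p::finite) bstack set" where
  "stiefel_prod = {Y. \<forall>i. slice Y i ** transpose (slice Y i) = mat 1}"

definition feasible :: "('m::finite, 'd::finite) bmat set" where
  "feasible = {X. X \<in> sym_mats \<and> psd X \<and> (\<forall>i. block X i i = mat 1)}"

definition block_diagonal :: "('m::finite, 'd::finite) bmat \<Rightarrow> bool" where
  "block_diagonal M \<longleftrightarrow> (\<forall>i j. i \<noteq> j \<longrightarrow> block M i j = 0)"

definition symblockdiag :: "('m::finite, 'd::finite) bmat \<Rightarrow> ('m, 'd) bmat" where
  "symblockdiag M =
     (\<chi> a b. if fst a = fst b
        then ((1/2) *\<^sub>R (block M (fst a) (fst a) + transpose (block M (fst a) (fst a)))) $ snd a $ snd b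
        else 0)"

definition tangent_space ::
  "('m::finite, 'd::finite, 'p::finite) bstack \<Rightarrow> ('m, 'd, 'p) bstack set" where
  "tangent_space Y = {V. symblockdiag (V ** transpose Y + Y ** transpose V) = 0}"

definition lifted_cost ::
  "(('m::finite, 'd::finite) bmat \<Rightarrow> real) \<Rightarrow> ('m, 'd, 'p::finite) bstack \<Rightarrow> real" where
  "lifted_cost f Y = f (Y ** transpose Y)"

text \<open>
  The next two functions are the Euclidean gradient and Hessian of \<^const>\<open>lifted_cost\<close>, which is
  confirmed by the two lemmas that follow them.
\<close>

definition lifted_grad ::
  "(('m::finite, 'd::finite) bmat \<Rightarrow> real) \<Rightarrow> ('m, 'd, 'p::finite) bstack \<Rightarrow> ('m, 'd, 'p) bstack" where
  "lifted_grad f Y = 2 *\<^sub>R (sym_grad f (Y ** transpose Y) ** Y)"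

definition lifted_hess ::
  "(('m::finite, 'd::finite) bmat \<Rightarrow> real) \<Rightarrow> ('m, 'd, 'p::finite) bstack \<Rightarrow>
   ('m, 'd, 'p) bstack \<Rightarrow> ('m, 'd, 'p) bstack" where
  "lifted_hess f Y V =
     2 *\<^sub>R (sym_hess f (Y ** transpose Y) (V ** transpose Y + Y ** transpose V) ** Y
          + sym_grad f (Y ** transpose Y) ** V)"

lemma bounded_bilinear_matrix_mult:
  "bounded_bilinear ((**) :: real ^ 'b::finite ^ 'a::finite \<Rightarrow> real ^ 'c::finite ^ 'b \<Rightarrow> real ^ 'c ^ 'a)"
  unfolding bilinear_conv_bounded_bilinear[symmetric] bilinear_def
  by (intro conjI allI linearI)
    (simp_all add: matrix_matrix_mult_def vec_eq_iff distrib_left distrib_right sum.distrib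
      sum_distrib_left mult_ac)

lemma gram_has_derivative:
  fixes Y :: "real ^ 'p::finite ^ 'a::finite"
  shows "((\<lambda>Y. Y ** transpose Y) has_derivative (\<lambda>V. V ** transpose Y + Y ** transpose V)) (at Y)"
proof -
  have "bounded_linear (transpose :: real ^ 'p ^ 'a \<Rightarrow> real ^ 'a ^ 'p)"
    by (auto intro!: linearI simp: linear_conv_bounded_linear[symmetric] transpose_def vec_eq_iff)
  from bounded_bilinear.FDERIV[OF bounded_bilinear_matrix_mult has_derivative_ident
      bounded_linear_imp_has_derivative[OF this], of Y UNIV]
  show ?thesis by (simp only: add.commute)
qed

lemma gram_sym: "Y ** transpose Y \<in> sym_mats" for Y :: "real ^ 'p::finite ^ 'a::finite"
  by (simp add: sym_mats_def matrix_transpose_mul)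

lemma mat_inner_gram_derivative:
  fixes G :: "real ^ 'a::finite ^ 'a" and Y V :: "real ^ 'p::finite ^ 'a"
  assumes G: "G \<in> sym_mats"
  shows "mat_inner G (V ** transpose Y + Y ** transpose V) = mat_inner (2 *\<^sub>R (G ** Y)) V"
proof -
  have 1: "mat_inner G (V ** transpose Y) = mat_inner (G ** Y) V"
    using trace_mul_sym[of "transpose G ** V" "transpose Y"]
    by (simp add: mat_inner_def matrix_mul_assoc matrix_transpose_mul)
  have "mat_inner G (Y ** transpose V) = trace (transpose (G ** Y ** transpose V))"
    using G by (simp add: mat_inner_def matrix_mul_assoc sym_mats_def trace_def transpose_def)
  also have "\<dots> = trace (V ** transpose (G ** Y))"
    by (simp add: matrix_transpose_mul)
  also have "\<dots> = mat_inner (G ** Y) V"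
    unfolding mat_inner_def by (rule trace_mul_sym)
  finally show ?thesis
    using 1 by (simp add: mat_inner_eq_inner inner_add_right)
qed

lemma lifted_grad:
  assumes "f differentiable_on sym_mats"
  shows "(lifted_cost f has_derivative (\<lambda>V. mat_inner (lifted_grad f Y) V)) (at Y)"
proof -
  let ?X = "Y ** transpose Y"
  have d: "f differentiable (at ?X within sym_mats)"
    using assms gram_sym by (auto simp: differentiable_on_def)
  have "(f has_derivative (\<lambda>H. mat_inner (sym_grad f ?X) H)) (at ?X within range (\<lambda>Y. Y ** transpose Y))"
    by (rule has_derivative_subset[OF sym_grad(2)[OF d gram_sym]]) (use gram_sym in auto)
  from has_derivative_in_compose[OF gram_has_derivative this]
  show ?thesis
    unfolding lifted_cost_def[abs_def] lifted_grad_def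
      mat_inner_gram_derivative[OF sym_grad(1)[OF d gram_sym]] .
qed

lemma lifted_hess:
  assumes "sym_grad f differentiable_on sym_mats"
  shows "(lifted_grad f has_derivative lifted_hess f Y) (at Y)"
proof -
  let ?X = "Y ** transpose Y"
  have "(sym_grad f has_derivative sym_hess f ?X) (at ?X within sym_mats)"
    using assms gram_sym unfolding sym_hess_def
    by (auto simp: differentiable_on_def simp flip: frechet_derivative_works)
  then have "(sym_grad f has_derivative sym_hess f ?X) (at ?X within range (\<lambda>Y. Y ** transpose Y))"
    by (rule has_derivative_subset) (use gram_sym in auto)
  from has_derivative_in_compose[OF gram_has_derivative this]
  have "((\<lambda>Y. sym_grad f (Y ** transpose Y)) has_derivative
      (\<lambda>V. sym_hess f ?X (V ** transpose Y + Y ** transpose V))) (at Y)" .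
  from has_derivative_scaleR_right[OF
      bounded_bilinear.FDERIV[OF bounded_bilinear_matrix_mult this has_derivative_ident], of 2]
  show ?thesis
    unfolding lifted_grad_def[abs_def] lifted_hess_def[abs_def] by (simp add: add.commute)
qed

definition critical_point ::
  "(('m::finite, 'd::finite) bmat \<Rightarrow> real) \<Rightarrow> ('m, 'd, 'p::finite) bstack \<Rightarrow> bool" where
  "critical_point f Y \<longleftrightarrow>
     Y \<in> stiefel_prod \<and>
     (let X = Y ** transpose Y
      in (sym_grad f X - symblockdiag (sym_grad f X ** X)) ** Y = 0)"

definition second_order_critical_point ::
  "(('m::finite, 'd::finite) bmat \<Rightarrow> real) \<Rightarrow> ('m, 'd, 'p::finite) bstack \<Rightarrow> bool" where
  "second_order_critical_point f Y \<longleftrightarrow>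
     critical_point f Y \<and>
     (\<forall>V\<in>tangent_space Y.
        0 \<le> mat_inner V (lifted_hess f Y V - symblockdiag (lifted_grad f Y ** transpose Y) ** V))"

definition KKT_point ::
  "(('m::finite, 'd::finite) bmat \<Rightarrow> real) \<Rightarrow> ('m, 'd) bmat \<Rightarrow> bool" where
  "KKT_point f X \<longleftrightarrow>
     X \<in> feasible \<and>
     (\<exists>S \<Lambda>. S \<in> sym_mats \<and> \<Lambda> \<in> sym_mats \<and> block_diagonal \<Lambda> \<and>
        S ** X = 0 \<and> S = sym_grad f X + \<Lambda> \<and> psd S)"

end

theory Submission
  imports Defs
begin

text \<open>
  A rank-deficient \<open>Y\<close> annihilates some \<open>z \<noteq> 0\<close>. Along a direction \<open>V = x z\<^sup>T\<close> the derivative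
  of \<open>Y Y\<^sup>T\<close> vanishes, so \<open>V\<close> is tangent and the Hessian term of \<open>f\<close> drops out: the second-order
  condition reads \<open>\<parallel>z\<parallel>\<^sup>2 x\<^sup>T S x \<ge> 0\<close> with \<open>S = \<nabla>f(X) - symblockdiag(\<nabla>f(X) X)\<close>. As \<open>x\<close> is
  arbitrary, \<open>S\<close> is positive semidefinite, and \<open>S Y = 0\<close> gives complementarity.
\<close>

definition outer :: "real ^ 'a::finite \<Rightarrow> real ^ 'b::finite \<Rightarrow> real ^ 'b ^ 'a" where
  "outer x z = (\<chi> i j. x $ i * z $ j)"

lemma outer_mult_transpose: "outer x z ** transpose A = outer x (A *v z)"
  by (simp add: outer_def matrix_matrix_mult_def matrix_vector_mult_def transpose_def vec_eq_iff
      sum_distrib_left mult_ac)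

lemma mult_transpose_outer: "A ** transpose (outer x z) = outer (A *v z) x"
  by (simp add: outer_def matrix_matrix_mult_def matrix_vector_mult_def transpose_def vec_eq_iff
      sum_distrib_left mult_ac)

lemma mult_outer: "M ** outer x z = outer (M *v x) z"
  by (simp add: outer_def matrix_matrix_mult_def matrix_vector_mult_def vec_eq_iff
      sum_distrib_left mult_ac)

lemma outer_zero [simp]: "outer x 0 = 0" "outer 0 z = 0"
  by (simp_all add: outer_def vec_eq_iff)

lemma inner_outer: "outer x z \<bullet> outer y w = (x \<bullet> y) * (z \<bullet> w)"
  unfolding outer_def inner_vec_def sum_product by (simp add: mult_ac)

lemma scaleR_matrix_mult: "(c *\<^sub>R A) ** B = c *\<^sub>R (A ** B)"
  for A :: "real ^ 'b::finite ^ 'a::finite" and B :: "real ^ 'c::finite ^ 'b"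
  by (rule bounded_bilinear.scaleR_left[OF bounded_bilinear_matrix_mult])

lemma symblockdiag_sym: "symblockdiag M \<in> sym_mats"
  by (auto simp: sym_mats_def symblockdiag_def block_def transpose_def vec_eq_iff)

lemma symblockdiag_zero: "symblockdiag 0 = 0"
  by (simp add: symblockdiag_def block_def transpose_def vec_eq_iff)

lemma symblockdiag_scaleR: "symblockdiag (c *\<^sub>R M) = c *\<^sub>R symblockdiag M"
  by (simp add: symblockdiag_def block_def transpose_def vec_eq_iff algebra_simps)

lemma block_diagonal_symblockdiag: "block_diagonal (symblockdiag M)"
  by (simp add: block_diagonal_def symblockdiag_def block_def vec_eq_iff)

lemma block_diagonal_minus: "block_diagonal M \<Longrightarrow> block_diagonal (- M)"
  by (simp add: block_diagonal_def block_def vec_eq_iff)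

lemma psd_gram: "psd (Y ** transpose Y)"
  for Y :: "real ^ 'p::finite ^ 'a::finite"
proof -
  have "x \<bullet> ((Y ** transpose Y) *v x) = (transpose Y *v x) \<bullet> (transpose Y *v x)" for x
    by (simp add: matrix_vector_mul_assoc[symmetric] dot_lmul_matrix[symmetric])
  then show ?thesis by (simp add: psd_def gram_sym)
qed

text \<open>For \<open>j = i\<close> this turns the orthonormality of the slices in
  \<open>stiefel_prod\<close> into the identity diagonal blocks required by
  \<open>feasible\<close>.\<close>

lemma block_gram: "block (Y ** transpose Y) i j = slice Y i ** transpose (slice Y j)"
  by (simp add: block_def slice_def matrix_matrix_mult_def transpose_def)

lemma gram_feasible: "Y \<in> stiefel_prod \<Longrightarrow> Y ** transpose Y \<in> feasible"
  by (simp add: feasible_def stiefel_prod_def gram_sym psd_gram block_gram)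

text \<open>\<open>sym_hess\<close> is a derivative picked by choice. Where \<open>sym_grad\<close>
  is differentiable, it agrees on symmetric directions with every derivative \<open>D\<close>, and
  linearity of \<open>D\<close> settles the symmetric direction 0.\<close>

lemma sym_hess_zero:
  assumes "sym_grad f differentiable (at X within sym_mats)" and "X \<in> sym_mats"
  shows "sym_hess f X 0 = 0"
proof -
  obtain D where D: "(sym_grad f has_derivative D) (at X within sym_mats)"
    using assms(1) by (auto simp: differentiable_def)
  show ?thesis
    using sym_hess_eq[OF D assms(2) subspace_0[OF subspace_sym_mats]]
      linear_0[OF has_derivative_linear[OF D]] by simp
qed

text \<open>Up to the factor \<open>2 * (z \<bullet> z)\<close>, the quadratic form at
  \<open>x\<close> is the Riemannian Hessian form at \<open>outer x z\<close>. A single kernel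
  vector \<open>z\<close> thus serves every \<open>x\<close>.\<close>

lemma certificate_nonneg:
  fixes f :: "('m::finite, 'd::finite) bmat \<Rightarrow> real"
    and Y :: "('m, 'd, 'p::finite) bstack"
  defines "X \<equiv> Y ** transpose Y"
  assumes diff: "sym_grad f differentiable_on sym_mats"
    and soc: "second_order_critical_point f Y"
    and z: "z \<noteq> 0" "Y *v z = 0"
  shows "0 \<le> x \<bullet> ((sym_grad f X - symblockdiag (sym_grad f X ** X)) *v x)"
proof -
  let ?G = "sym_grad f X"
  let ?B = "symblockdiag (?G ** X)"
  let ?V = "outer x z"
  \<comment> \<open>The summands are \<open>outer x (Y *v z)\<close> and
    \<open>outer (Y *v z) x\<close>, so both vanish with \<open>Y *v z\<close>.\<close>
  have dX: "?V ** transpose Y + Y ** transpose ?V = 0"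
    by (simp add: outer_mult_transpose mult_transpose_outer z)
  then have "?V \<in> tangent_space Y"
    by (simp add: tangent_space_def symblockdiag_zero)
  then have "0 \<le> ?V \<bullet> (lifted_hess f Y ?V - symblockdiag (lifted_grad f Y ** transpose Y) ** ?V)"
    using soc by (simp add: second_order_critical_point_def mat_inner_eq_inner)
  also have "lifted_hess f Y ?V = 2 *\<^sub>R outer (?G *v x) z"
  proof -
    have "sym_hess f X 0 = 0"
      using diff by (intro sym_hess_zero) (auto simp: differentiable_on_def X_def gram_sym)
    then show ?thesis
      unfolding lifted_hess_def dX X_def[symmetric] by (simp add: mult_outer)
  qed
  \<comment> \<open>Since \<open>lifted_grad f Y ** transpose Y\<close> is twice
    \<open>?G ** X\<close>, linearity of \<open>symblockdiag\<close> yields the same factor 2 as in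
    the Hessian term.\<close>
  also have "symblockdiag (lifted_grad f Y ** transpose Y) ** ?V = 2 *\<^sub>R outer (?B *v x) z"
    by (simp add: lifted_grad_def X_def scaleR_matrix_mult symblockdiag_scaleR
        mult_outer[symmetric] matrix_mul_assoc)
  also have "?V \<bullet> (2 *\<^sub>R outer (?G *v x) z - 2 *\<^sub>R outer (?B *v x) z)
      = 2 * (z \<bullet> z) * (x \<bullet> ((?G - ?B) *v x))"
    by (simp add: inner_diff_right inner_outer matrix_vector_mult_diff_rdistrib algebra_simps)
  finally have "0 \<le> (z \<bullet> z) * (x \<bullet> ((?G - ?B) *v x))" by simp
  moreover have "0 < z \<bullet> z" using z(1) by simp
  ultimately show ?thesis by (simp only: zero_le_mult_iff) linarith
qed

theorem theorem3p7:
  fixes f :: "('m::finite, 'd::finite) bmat \<Rightarrow> real"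
    and Y :: "('m, 'd, 'p::finite) bstack"
  assumes "CARD('d) \<le> CARD('p)"
    and "CARD('p) \<le> CARD('m) * CARD('d)"
    and "twice_cont_diff f"
    and "Y \<in> stiefel_prod"
    and "rank Y < CARD('p)"
    and "second_order_critical_point f Y"
  shows "KKT_point f (Y ** transpose Y)"
proof -
  define X where "X = Y ** transpose Y"
  \<comment> \<open>The multiplier of the KKT conditions will be \<open>- B\<close>.\<close>
  define B where "B = symblockdiag (sym_grad f X ** X)"
  define S where "S = sym_grad f X - B"
  have f: "f differentiable_on sym_mats" and g: "sym_grad f differentiable_on sym_mats"
    using assms(3) by (auto simp: twice_cont_diff_def)
  have X: "X \<in> sym_mats" by (simp add: X_def gram_sym)
  have B: "B \<in> sym_mats" by (simp add: B_def symblockdiag_sym)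
  have S: "S \<in> sym_mats"
    using f X B unfolding S_def
    by (intro subspace_diff[OF subspace_sym_mats] sym_grad) (auto simp: differentiable_on_def)
  \<comment> \<open>Rank below the number of columns means a nontrivial kernel.\<close>
  obtain z where "z \<noteq> 0" "Y *v z = 0"
    using assms(5) matrix_nonfull_linear_equations_eq[of Y] by auto
  then have "psd S"
    using S certificate_nonneg[OF g assms(6)] by (auto simp: psd_def S_def B_def X_def)
  moreover have "S ** X = 0"
  proof -
    \<comment> \<open>This is first-order criticality itself; multiplying by
      \<open>transpose Y\<close> on the right gives complementarity.\<close>
    have "S ** Y = 0"
      using assms(6)
      by (simp add: second_order_critical_point_def critical_point_def Let_def S_def B_def X_def)
    then show ?thesis by (simp add: X_def matrix_mul_assoc)
  qed
  moreover have "- B \<in> sym_mats" "block_diagonal (- B)"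
    using subspace_neg[OF subspace_sym_mats B]
    by (auto simp: B_def block_diagonal_symblockdiag block_diagonal_minus)
  moreover have "S = sym_grad f X + - B" by (simp add: S_def)
  ultimately show ?thesis
    using S gram_feasible[OF assms(4)] unfolding KKT_point_def X_def[symmetric] by blast
qed

end
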